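(* Let $K_n=(V,E^+,E^-)$ be a complete signed graph with $n=|V|$. 1) If $K_n$ is (weakly) $k$-balanced ($k\geq1$) with partition $V=(V_1,\dots,V_k)$ into the vertex sets of the connected components of $(V,E^+)$, where $|V_1|\geq|V_2|\geq\dots\geq|V_k|$, then $a_{so}(K_n)=|V_1|$ and $V_1$ is a minimum offensive alliance. Moreover, if $S=S_1\cup S_2\cup\dots\cup S_p$ with $p\geq 2$, where $\emptyset\subsetneq S_1\subseteq V_{i_1},\dots,\emptyset\subsetneq S_p\subseteq V_{i_p}$ and $i_1\leq i_2\leq\dots\leq i_p$, then $S$ is a minimum offensive alliance if and only if $|S|=|V_1|\geq 2|S_l|$, where $l=\arg\max_{j\in\{1,\dots,p\}}\{|S_j| : V_{i_j}\setminus S_j\neq\emptyset\}$. 2) If $K_n$ is (weakly) $k$-anti-balanced ($k\geq1$) with partition $V=(V_1,\dots,V_k)$ into the vertex sets of the connected components of $(V,E^-)$, where $|V_1|\geq|V_2|\geq\dots\geq|V_k|$, then: i) if $V=V_1\cup V_2$ and $|V_1|\geq|V_2|\geq\left\lceil\frac{n+1}{3}\right\rceil$, then $a_{so}(K_n)=2\left\lceil\frac{|V_1|+1}{2}\right\rceil$, and for any $S_1\subseteq V_1$ and $S_2\subseteq V_2$ with $|S_1|=|S_2|=\left\lceil\frac{|V_1|+1}{2}\right\rceil$, the set $S_1\cup S_2$ is a minimum offensive alliance; ii) if $|V_1|\geq\frac n2$, then $a_{so}(K_n)=\max\{n-|V_1|+1,\,2(n-|V_1|)\}$, and for any $S_1\subseteq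 V_1$ with $|S_1|=n-|V_1|$, the set $S_1\cup(V\setminus V_1)$ is a minimum offensive alliance; iii) otherwise, $a_{so}(K_n)=n$.
   Context: A signed graph is a triple $G=(V,E^+,E^-)$ with $V$ finite, $E^+,E^-\subseteq\binom{V}{2}$ and $E^+\cap E^-=\emptyset$. It is complete if $E^+\cup E^-=\binom{V}{2}$. A complete signed graph is (weakly) $k$-balanced if the unsigned graph $(V,E^+)$ has exactly $k$ connected components (each then a clique, with no negative edge inside any component); it is (weakly) $k$-anti-balanced if $(V,E^-)$ has exactly $k$ connected components (with no positive edge inside any component). $N^+(v)=\{u: uv\in E^+\}$, $N^-(v)=\{u: uv\in E^-\}$, $N(v)=N^+(v)\cup N^-(v)$. For $X\subseteq V$, $\deg^+_X(v)=|N^+(v)\cap X|$, $\deg^-_X(v)=|N^-(v)\cap X|$, $\overline{X}=V\setminus X$. For $S\subseteq V$, $\partial S=\left(\bigcup_{u\in S}N(u)\right)\setminus S$. A set $S\subseteq V$ is an offensive alliance if for every $w\in\partial S$: (1) $\deg^-_S(w)\geq \deg^+_S(w)$ and (2) $\deg^-_S(w)\geq \deg^+_{\overline S}(w)+1$. $a_{so}(G)$ is the size of a smallest non-empty offensive alliance of $G$; a minimum offensive alliance is a non-empty offensive alliance of that size.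
   Formalization: In 1) the indices are taken strictly increasing, i_1<...<i_p (false with repeats); if no l exists the bound on |S_l| is void; in 2) case ii) is claimed only when i) fails (else they conflict), and its set S_1∪(V\V_1) must be non-empty (it is empty when k=1). *)

theory Defs
  imports Complex_Main "HOL-Library.Ramsey"
begin

record 'a sgraph =
  verts :: "'a set"
  pos_edges :: "'a set set"
  neg_edges :: "'a set set"

definition signed_graph :: "'a sgraph \<Rightarrow> bool" where
  "signed_graph G \<longleftrightarrow> finite (verts G) \<and>
     pos_edges G \<subseteq> nsets (verts G) 2 \<and> neg_edges G \<subseteq> nsets (verts G) 2 \<and>
     pos_edges G \<inter> neg_edges G = {}"

definition complete_signed_graph :: "'a sgraph \<Rightarrow> bool" where
  "complete_signed_graph G \<longleftrightarrow>
     signed_graph G \<and> pos_edges G \<union> neg_edges G = nsets (verts G) 2"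

definition components :: "'a set \<Rightarrow> 'a set set \<Rightarrow> 'a set set" where
  "components V E = V // {(u, v). u \<in> V \<and> v \<in> V \<and> (u, v) \<in> {(x, y). {x, y} \<in> E}\<^sup>*}"

text \<open>Completeness and the number of components alone do not make every component of
  the positive graph a clique (take a triangle with exactly one negative edge), so the
  absence of negative edges inside the components is required explicitly.\<close>

definition weakly_balanced :: "'a sgraph \<Rightarrow> nat \<Rightarrow> bool" where
  "weakly_balanced G k \<longleftrightarrow> complete_signed_graph G \<and>
     card (components (verts G) (pos_edges G)) = k \<and>
     (\<forall>C \<in> components (verts G) (pos_edges G). \<forall>e \<in> neg_edges G. \<not> e \<subseteq> C)"

definition weakly_anti_balanced :: "'a sgraph \<Rightarrow> nat \<Rightarrow> bool" where
  "weakly_anti_balanced G k \<longleftrightarrow> complete_signed_graph G \<and>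
     card (components (verts G) (neg_edges G)) = k \<and>
     (\<forall>C \<in> components (verts G) (neg_edges G). \<forall>e \<in> pos_edges G. \<not> e \<subseteq> C)"

text \<open>\<open>P 1, \<dots>, P k\<close> enumerates the components of the graph \<open>(V, E)\<close> without
  repetition, by non-increasing size; values of \<open>P\<close> outside \<open>{1..k}\<close> are irrelevant.\<close>

definition ordered_components :: "'a set \<Rightarrow> 'a set set \<Rightarrow> nat \<Rightarrow> (nat \<Rightarrow> 'a set) \<Rightarrow> bool" where
  "ordered_components V E k P \<longleftrightarrow> bij_betw P {1..k} (components V E) \<and>
     (\<forall>i \<in> {1..k}. \<forall>j \<in> {1..k}. i \<le> j \<longrightarrow> card (P i) \<ge> card (P j))"

definition pos_nbrs :: "'a sgraph \<Rightarrow> 'a \<Rightarrow> 'a set" where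
  "pos_nbrs G v = {u. {u, v} \<in> pos_edges G}"

definition neg_nbrs :: "'a sgraph \<Rightarrow> 'a \<Rightarrow> 'a set" where
  "neg_nbrs G v = {u. {u, v} \<in> neg_edges G}"

definition nbrs :: "'a sgraph \<Rightarrow> 'a \<Rightarrow> 'a set" where
  "nbrs G v = pos_nbrs G v \<union> neg_nbrs G v"

definition pos_deg :: "'a sgraph \<Rightarrow> 'a set \<Rightarrow> 'a \<Rightarrow> nat" where
  "pos_deg G X v = card (pos_nbrs G v \<inter> X)"

definition neg_deg :: "'a sgraph \<Rightarrow> 'a set \<Rightarrow> 'a \<Rightarrow> nat" where
  "neg_deg G X v = card (neg_nbrs G v \<inter> X)"

definition bdry :: "'a sgraph \<Rightarrow> 'a set \<Rightarrow> 'a set" where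
  "bdry G S = (\<Union>u\<in>S. nbrs G u) - S"

definition offensive_alliance :: "'a sgraph \<Rightarrow> 'a set \<Rightarrow> bool" where
  "offensive_alliance G S \<longleftrightarrow> S \<subseteq> verts G \<and>
     (\<forall>w \<in> bdry G S. neg_deg G S w \<ge> pos_deg G S w \<and>
                     neg_deg G S w \<ge> pos_deg G (verts G - S) w + 1)"

definition a_so :: "'a sgraph \<Rightarrow> nat" where
  "a_so G = (LEAST m. \<exists>S. S \<noteq> {} \<and> offensive_alliance G S \<and> card S = m)"

definition minimum_offensive_alliance :: "'a sgraph \<Rightarrow> 'a set \<Rightarrow> bool" where
  "minimum_offensive_alliance G S \<longleftrightarrow>
     S \<noteq> {} \<and> offensive_alliance G S \<and> card S = a_so G"

end

theory Submission
  imports Defs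
begin

text \<open>In a complete signed graph the boundary of a non-empty set \<open>S\<close> of vertices is its complement,
  and all vertices of one component \<open>V\<^sub>i\<close> outside \<open>S\<close> have the same degrees. Writing
  \<open>s\<^sub>i = \<bar>S \<inter> V\<^sub>i\<bar>\<close>, the set \<open>S\<close> is therefore an offensive alliance iff each \<open>V\<^sub>i\<close> not contained
  in \<open>S\<close> satisfies \<open>2 s\<^sub>i \<le> \<bar>S\<bar>\<close> and \<open>\<bar>V\<^sub>i\<bar> \<le> \<bar>S\<bar>\<close> in the balanced case, and
  \<open>2 s\<^sub>i \<ge> \<bar>S\<bar>\<close> and \<open>\<bar>S\<bar> + \<bar>V\<^sub>i\<bar> \<ge> n + 1\<close> in the anti-balanced case. The rest is counting: in
  the anti-balanced case at most two components can fail to be contained in \<open>S\<close>, and if two do,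
  they share \<open>S\<close> equally and there is no third component.\<close>

section \<open>Complete graphs whose components are cliques\<close>

text \<open>\<open>E\<close> is the sign occurring inside components and \<open>F\<close> the sign
  between them, so one development serves balanced graphs (\<open>E\<close> positive) and
  anti-balanced graphs (\<open>E\<close> negative).\<close>

locale ordered_clique_partition =
  fixes V :: "'a set" and E F :: "'a set set" and k :: nat and P :: "nat \<Rightarrow> 'a set"
  assumes fin: "finite V"
    and disj: "E \<inter> F = {}"
    and union: "E \<union> F = nsets V 2"
    and clique: "\<And>C e. C \<in> components V E \<Longrightarrow> e \<in> F \<Longrightarrow> \<not> e \<subseteq> C"
    and ordered: "ordered_components V E k P"
begin

definition connected_rel :: "('a \<times> 'a) set" where
  "connected_rel = {(u, v). u \<in> V \<and> v \<in> V \<and> (u, v) \<in> {(x, y). {x, y} \<in> E}\<^sup>*}"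

lemma components_eq: "components V E = V // connected_rel"
  by (simp add: components_def connected_rel_def)

lemma equiv_connected_rel: "equiv V connected_rel"
proof -
  have "sym {(x, y). {x, y} \<in> E}"
    by (auto simp: sym_def insert_commute)
  then have "sym ({(x, y). {x, y} \<in> E}\<^sup>*)"
    by (rule sym_rtrancl)
  then show ?thesis
    unfolding equiv_def refl_on_def sym_def trans_def connected_rel_def
    by (auto intro: rtrancl_trans)
qed

lemma image_P: "P ` {1..k} = V // connected_rel" and inj_P: "inj_on P {1..k}"
  using ordered by (auto simp: ordered_components_def components_eq bij_betw_def)

lemma P_in_quotient: "i \<in> {1..k} \<Longrightarrow> P i \<in> V // connected_rel"
  using image_P by blast

lemma card_P_mono: "i \<in> {1..k} \<Longrightarrow> j \<in> {1..k} \<Longrightarrow> i \<le> j \<Longrightarrow> card (P j) \<le> card (P i)"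
  using ordered by (auto simp: ordered_components_def)

lemma P_subset: "i \<in> {1..k} \<Longrightarrow> P i \<subseteq> V"
  using P_in_quotient Union_quotient[OF equiv_connected_rel] by blast

lemma P_nonempty: "i \<in> {1..k} \<Longrightarrow> P i \<noteq> {}"
  using P_in_quotient equiv_connected_rel by (metis in_quotient_imp_non_empty)

lemma finite_P: "i \<in> {1..k} \<Longrightarrow> finite (P i)"
  using P_subset fin finite_subset by blast

lemma P_disjoint:
  assumes "i \<in> {1..k}" "j \<in> {1..k}" "i \<noteq> j"
  shows "P i \<inter> P j = {}"
  using quotient_disj[OF equiv_connected_rel P_in_quotient P_in_quotient] assms inj_P
  by (metis inj_on_eq_iff)

lemma Union_P: "(\<Union>i\<in>{1..k}. P i) = V"
  using image_P Union_quotient[OF equiv_connected_rel] by metis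

lemma ex_P:
  assumes "w \<in> V"
  obtains i where "i \<in> {1..k}" "w \<in> P i"
  using Union_P assms by blast

text \<open>An \<open>E\<close>-edge is a path of length one, so its ends share a component.
  Conversely \<open>clique\<close> forbids an \<open>F\<close>-edge inside a component, and
  completeness leaves only \<open>E\<close>.\<close>

lemma edge_iff:
  assumes "i \<in> {1..k}" "w \<in> P i" "u \<in> V" "u \<noteq> w"
  shows "{u, w} \<in> E \<longleftrightarrow> u \<in> P i"
proof
  have w: "w \<in> V" using P_subset assms by blast
  assume "{u, w} \<in> E"
  then have "(w, u) \<in> connected_rel"
    using assms w by (auto simp: connected_rel_def insert_commute)
  then show "u \<in> P i"
    using in_quotient_imp_closed[OF equiv_connected_rel P_in_quotient] assms by blast
next
  have w: "w \<in> V" using P_subset assms by blast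
  assume "u \<in> P i"
  then have "{u, w} \<notin> F"
    using clique[of "P i" "{u, w}"] P_in_quotient assms by (auto simp: components_eq)
  moreover have "{u, w} \<in> nsets V 2"
    using assms w by (auto simp: nsets_def)
  ultimately show "{u, w} \<in> E" using union by blast
qed

text \<open>Up to \<open>w\<close> itself, the neighbourhoods depend only on the component of
  \<open>w\<close>; this is what turns the alliance conditions into counts per component.\<close>

lemma
  assumes "i \<in> {1..k}" "w \<in> P i"
  shows E_nbrs: "{u. {u, w} \<in> E} = P i - {w}"
    and F_nbrs: "{u. {u, w} \<in> F} = V - P i"
proof -
  have w: "w \<in> V" using P_subset assms by blast
  have pair: "{u, w} \<in> E \<union> F \<longleftrightarrow> u \<in> V \<and> u \<noteq> w" for u
    unfolding union using w by (auto simp: nsets_def card_insert_if)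
  show "{u. {u, w} \<in> E} = P i - {w}"
    using pair edge_iff[OF assms] P_subset[OF assms(1)] by blast
  show "{u. {u, w} \<in> F} = V - P i"
    using pair edge_iff[OF assms] assms disj by blast
qed

lemma card_two_parts_le:
  assumes "S \<subseteq> V" "i \<in> {1..k}" "j \<in> {1..k}" "i \<noteq> j"
  shows "card (S \<inter> P i) + card (S \<inter> P j) \<le> card S"
proof -
  have "finite S" using assms fin finite_subset by blast
  moreover have "(S \<inter> P i) \<inter> (S \<inter> P j) = {}" using P_disjoint assms by blast
  ultimately have "card (S \<inter> P i) + card (S \<inter> P j) = card (S \<inter> P i \<union> S \<inter> P j)"
    by (simp add: card_Un_disjoint)
  also have "\<dots> \<le> card S" using \<open>finite S\<close> by (intro card_mono) auto
  finally show ?thesis .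
qed

text \<open>Subtraction on \<open>nat\<close> truncates, so each difference comes with the
  inequality that makes it exact for linear arithmetic.\<close>

lemma card_Diff_P:
  assumes "S \<subseteq> V" "i \<in> {1..k}"
  shows "card (S - P i) = card S - card (S \<inter> P i)" "card (S \<inter> P i) \<le> card S"
    "card (P i - S) = card (P i) - card (S \<inter> P i)" "card (S \<inter> P i) \<le> card (P i)"
    "card (V - P i) = card V - card (P i)" "card (P i) \<le> card V"
proof -
  have "finite S" using assms fin finite_subset by blast
  then show "card (S - P i) = card S - card (S \<inter> P i)" "card (S \<inter> P i) \<le> card S"
    by (auto simp: card_Diff_subset_Int intro: card_mono)
  show "card (P i - S) = card (P i) - card (S \<inter> P i)" "card (S \<inter> P i) \<le> card (P i)"
    using finite_P[OF assms(2)]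
    by (auto simp: card_Diff_subset_Int Int_commute intro: card_mono)
  show "card (V - P i) = card V - card (P i)" "card (P i) \<le> card V"
    using finite_P[OF assms(2)] fin P_subset[OF assms(2)]
    by (auto simp: card_Diff_subset intro: card_mono)
qed

lemma part_le_1:
  assumes "i \<in> {1..k}"
  shows "card (P i) \<le> card (P 1)"
  using assms card_P_mono[of 1 i] by auto

lemma card_P_pos: "i \<in> {1..k} \<Longrightarrow> card (P i) > 0"
  using finite_P P_nonempty by (simp add: card_gt_0_iff)

lemma card_not_subset:
  assumes "i \<in> {1..k}" "\<not> P i \<subseteq> S"
  shows "card (S \<inter> P i) < card (P i)"
  using finite_P[OF assms(1)] assms(2) by (intro psubset_card_mono) auto

end

section \<open>Alliances in complete signed graphs\<close>

text \<open>A single vertex of \<open>S\<close> is already adjacent to every vertex outside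
  \<open>S\<close>.\<close>

lemma bdry_complete:
  assumes "complete_signed_graph G" "S \<subseteq> verts G" "S \<noteq> {}"
  shows "bdry G S = verts G - S"
proof -
  have pair: "{u, v} \<in> pos_edges G \<union> neg_edges G \<longleftrightarrow> u \<in> verts G \<and> v \<in> verts G \<and> u \<noteq> v" for u v
    using assms by (auto simp: complete_signed_graph_def nsets_def card_insert_if)
  then have "nbrs G u = verts G - {u}" if "u \<in> verts G" for u
    using that by (fastforce simp: nbrs_def pos_nbrs_def neg_nbrs_def)
  then show ?thesis
    using assms unfolding bdry_def by blast
qed

lemma offensive_alliance_verts: "complete_signed_graph G \<Longrightarrow> offensive_alliance G (verts G)"
  by (cases "verts G = {}") (auto simp: offensive_alliance_def bdry_complete, auto simp: bdry_def)

lemma a_so_eqI: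
  assumes "offensive_alliance G S" "S \<noteq> {}" "card S = m"
    and "\<And>T. offensive_alliance G T \<Longrightarrow> T \<noteq> {} \<Longrightarrow> m \<le> card T"
  shows "a_so G = m"
  unfolding a_so_def using assms by (intro Least_equality) auto

section \<open>Balanced graphs\<close>

locale balanced_graph =
  ordered_clique_partition "verts G" "pos_edges G" "neg_edges G" k P
  for G :: "'a sgraph" and k P
begin

lemma complete: "complete_signed_graph G"
  using fin disj union by (auto simp: complete_signed_graph_def signed_graph_def)

text \<open>With \<open>s = card (S \<inter> P i)\<close>, a vertex of \<open>P i - S\<close> has
  negative degree \<open>card S - s\<close> and positive degree \<open>s\<close> into
  \<open>S\<close>, and positive degree \<open>card (P i) - s - 1\<close> outside \<open>S\<close>.
  In the second alliance condition \<open>s\<close> cancels.\<close>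

lemma alliance_iff:
  assumes S: "S \<subseteq> verts G" "S \<noteq> {}"
  shows "offensive_alliance G S \<longleftrightarrow>
    (\<forall>i\<in>{1..k}. \<not> P i \<subseteq> S \<longrightarrow> 2 * card (S \<inter> P i) \<le> card S \<and> card (P i) \<le> card S)"
proof -
  have cond: "neg_deg G S w \<ge> pos_deg G S w \<and> neg_deg G S w \<ge> pos_deg G (verts G - S) w + 1 \<longleftrightarrow>
      2 * card (S \<inter> P i) \<le> card S \<and> card (P i) \<le> card S"
    if i: "i \<in> {1..k}" and w: "w \<in> P i" "w \<notin> S" for i w
  proof -
    have "neg_nbrs G w \<inter> S = S - P i" "pos_nbrs G w \<inter> S = S \<inter> P i"
      "pos_nbrs G w \<inter> (verts G - S) = P i - S - {w}"
      using E_nbrs[OF i w(1)] F_nbrs[OF i w(1)] S(1) w(2) P_subset[OF i]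
      by (auto simp: neg_nbrs_def pos_nbrs_def)
    \<comment> \<open>\<open>w\<close> is not its own neighbour; this missing vertex absorbs the
      \<open>+ 1\<close> of the second condition.\<close>
    moreover have "card (P i - S) = card (P i - S - {w}) + 1"
      using card.remove[of "P i - S" w] finite_P[OF i] w by simp
    ultimately show ?thesis
      using card_Diff_P[OF S(1) i] by (auto simp: neg_deg_def pos_deg_def)
  qed
  show ?thesis
    unfolding offensive_alliance_def bdry_complete[OF complete S]
  proof (intro iffI conjI ballI impI)
    fix i assume *: "S \<subseteq> verts G \<and> (\<forall>w\<in>verts G - S. neg_deg G S w \<ge> pos_deg G S w \<and>
        neg_deg G S w \<ge> pos_deg G (verts G - S) w + 1)" and i: "i \<in> {1..k}" "\<not> P i \<subseteq> S"
    then obtain w where "w \<in> P i" "w \<notin> S" by blast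
    with * i cond[of i w] P_subset[of i]
    show "2 * card (S \<inter> P i) \<le> card S" "card (P i) \<le> card S" by blast+
  next
    fix w assume *: "\<forall>i\<in>{1..k}. \<not> P i \<subseteq> S \<longrightarrow> 2 * card (S \<inter> P i) \<le> card S \<and> card (P i) \<le> card S"
      and w: "w \<in> verts G - S"
    then obtain i where "i \<in> {1..k}" "w \<in> P i" using ex_P by blast
    with * w cond[of i w]
    show "neg_deg G S w \<ge> pos_deg G S w" "neg_deg G S w \<ge> pos_deg G (verts G - S) w + 1" by blast+
  qed (use S in auto)
qed

lemma card_P_1_le:
  assumes "k \<ge> 1" "offensive_alliance G S" "S \<noteq> {}"
  shows "card (P 1) \<le> card S"
proof -
  have S: "S \<subseteq> verts G" using assms by (simp add: offensive_alliance_def)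
  show ?thesis
  proof (cases "P 1 \<subseteq> S")
    case True
    then show ?thesis using S fin by (meson card_mono finite_subset)
  next
    case False
    then show ?thesis using alliance_iff[OF S assms(3)] assms by auto
  qed
qed

text \<open>\<open>P 1\<close> is disjoint from every component not contained in it, so the first
  inequality of \<open>alliance_iff\<close> is trivial there; the second is the maximality of
  \<open>P 1\<close>.\<close>

lemma P_1_alliance:
  assumes "k \<ge> 1"
  shows "offensive_alliance G (P 1)"
proof -
  have 1: "1 \<in> {1..k}" using assms by simp
  have "2 * card (P 1 \<inter> P i) \<le> card (P 1) \<and> card (P i) \<le> card (P 1)"
    if "i \<in> {1..k}" "\<not> P i \<subseteq> P 1" for i
    using P_disjoint[OF 1 that(1)] part_le_1[OF that(1)] that(2) by (cases "i = 1") auto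
  then show ?thesis
    using alliance_iff[OF P_subset[OF 1] P_nonempty[OF 1]] by blast
qed

lemma a_so_eq: "k \<ge> 1 \<Longrightarrow> a_so G = card (P 1)"
  by (rule a_so_eqI[OF P_1_alliance]) (use P_nonempty[of 1] card_P_1_le in auto)

lemma P_1_minimum: "k \<ge> 1 \<Longrightarrow> minimum_offensive_alliance G (P 1)"
  using P_1_alliance a_so_eq P_nonempty[of 1] by (auto simp: minimum_offensive_alliance_def)

text \<open>Once \<open>card S = card (P 1)\<close>, maximality of \<open>P 1\<close> gives the
  second inequality of \<open>alliance_iff\<close>, and components missed by \<open>S\<close>
  satisfy the first. What remains is \<open>2 * card (T j) \<le> card S\<close> for the parts that
  do not fill their component, and it suffices to test the largest such part.\<close>

lemma minimum_Union_iff: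
  fixes p :: nat and i :: "nat \<Rightarrow> nat"
  assumes k: "k \<ge> 1" and p: "p \<ge> 2" and i: "i ` {1..p} \<subseteq> {1..k}"
    and mono: "strict_mono_on {1..p} i"
    and T: "\<And>j. j \<in> {1..p} \<Longrightarrow> T j \<noteq> {}" "\<And>j. j \<in> {1..p} \<Longrightarrow> T j \<subseteq> P (i j)"
    and S: "S = (\<Union>j\<in>{1..p}. T j)"
  shows "minimum_offensive_alliance G S \<longleftrightarrow> card S = card (P 1) \<and>
    (\<forall>l. is_arg_max (\<lambda>j. card (T j)) (\<lambda>j. j \<in> {1..p} \<and> P (i j) - T j \<noteq> {}) l \<longrightarrow>
      card (P 1) \<ge> 2 * card (T l))"
proof -
  have ik: "i j \<in> {1..k}" if "j \<in> {1..p}" for j using i that by blast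
  have Sne: "S \<noteq> {}" using T(1)[of 1] p by (auto simp: S)
  have Ssub: "S \<subseteq> verts G" using T(2) P_subset ik unfolding S by blast
  have inj: "inj_on i {1..p}" using mono by (rule strict_mono_on_imp_inj_on)
  \<comment> \<open>Injectivity of \<open>i\<close> puts different parts into different components,
    so no other part contributes to \<open>P (i j)\<close>.\<close>
  have ST: "S \<inter> P (i j) = T j" if j: "j \<in> {1..p}" for j
  proof
    show "T j \<subseteq> S \<inter> P (i j)" using T(2) j unfolding S by blast
    show "S \<inter> P (i j) \<subseteq> T j"
    proof
      fix x assume x: "x \<in> S \<inter> P (i j)"
      then obtain j' where j': "j' \<in> {1..p}" "x \<in> T j'" unfolding S by blast
      then have "x \<in> P (i j')" using T(2) by blast
      then have "i j' = i j" using x P_disjoint ik j j' by blast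
      then show "x \<in> T j" using inj j j' by (auto dest: inj_onD)
    qed
  qed
  have other: "S \<inter> P r = {}" if "r \<in> {1..k}" "r \<notin> i ` {1..p}" for r
  proof -
    have "T j \<inter> P r = {}" if "j \<in> {1..p}" for j
      using T(2)[OF that] P_disjoint[OF ik[OF that] \<open>r \<in> {1..k}\<close>] that \<open>r \<notin> i ` {1..p}\<close> by blast
    then show ?thesis unfolding S by blast
  qed
  let ?Q = "\<lambda>j. j \<in> {1..p} \<and> P (i j) - T j \<noteq> {}"
  have notsub: "\<not> P (i j) \<subseteq> S \<longleftrightarrow> P (i j) - T j \<noteq> {}" if "j \<in> {1..p}" for j
    using ST[OF that] by blast
  have allianceS: "offensive_alliance G S \<longleftrightarrow> (\<forall>j. ?Q j \<longrightarrow> 2 * card (T j) \<le> card S)"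
    if c: "card S = card (P 1)"
  proof -
    have "offensive_alliance G S \<longleftrightarrow> (\<forall>r\<in>{1..k}. \<not> P r \<subseteq> S \<longrightarrow> 2 * card (S \<inter> P r) \<le> card S)"
      using alliance_iff[OF Ssub Sne] part_le_1 c by auto
    also have "\<dots> \<longleftrightarrow> (\<forall>j\<in>{1..p}. \<not> P (i j) \<subseteq> S \<longrightarrow> 2 * card (S \<inter> P (i j)) \<le> card S)"
    proof (intro iffI ballI impI)
      fix r assume *: "\<forall>j\<in>{1..p}. \<not> P (i j) \<subseteq> S \<longrightarrow> 2 * card (S \<inter> P (i j)) \<le> card S"
        and r: "r \<in> {1..k}" "\<not> P r \<subseteq> S"
      show "2 * card (S \<inter> P r) \<le> card S"
      proof (cases "r \<in> i ` {1..p}")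
        case True
        then show ?thesis using * r by blast
      next
        case False
        then show ?thesis using other r by simp
      qed
    qed (use ik in blast)
    also have "\<dots> \<longleftrightarrow> (\<forall>j. ?Q j \<longrightarrow> 2 * card (T j) \<le> card S)"
      using ST notsub by auto
    finally show ?thesis .
  qed
  \<comment> \<open>If some \<open>j\<close> satisfies \<open>?Q\<close>, a maximiser exists because
    the index set is finite; otherwise both sides hold vacuously.\<close>
  have argmax: "(\<forall>j. ?Q j \<longrightarrow> 2 * card (T j) \<le> m) \<longleftrightarrow>
      (\<forall>l. is_arg_max (\<lambda>j. card (T j)) ?Q l \<longrightarrow> m \<ge> 2 * card (T l))" for m
  proof (intro iffI allI impI)
    fix j assume *: "\<forall>l. is_arg_max (\<lambda>j. card (T j)) ?Q l \<longrightarrow> m \<ge> 2 * card (T l)" and j: "?Q j"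
    let ?M = "Max ((\<lambda>j. card (T j)) ` {j. ?Q j})"
    have fin: "finite ((\<lambda>j. card (T j)) ` {j. ?Q j})" by simp
    then have "?M \<in> (\<lambda>j. card (T j)) ` {j. ?Q j}" using j by (intro Max_in) blast+
    then obtain l where "?M = card (T l)" "l \<in> {j. ?Q j}" by (rule imageE)
    then have l: "?Q l" "card (T l) = ?M" by simp_all
    have le: "card (T j) \<le> card (T l)" if "?Q j" for j
      unfolding l(2) using fin that by (intro Max_ge) blast+
    then have "is_arg_max (\<lambda>j. card (T j)) ?Q l"
      using l(1) unfolding is_arg_max_def by (meson not_less)
    with * le[OF j] show "2 * card (T j) \<le> m" by fastforce
  qed (simp add: is_arg_max_def)
  show ?thesis
    using allianceS argmax[of "card S"] Sne
    unfolding minimum_offensive_alliance_def a_so_eq[OF k] by (metis (no_types, lifting))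
qed

end

section \<open>Anti-balanced graphs: the shape of an alliance\<close>

locale anti_balanced_graph =
  ordered_clique_partition "verts G" "neg_edges G" "pos_edges G" k P
  for G :: "'a sgraph" and k P +
  assumes k_pos: "k \<ge> 1"
begin

lemma complete: "complete_signed_graph G"
  using fin disj union by (auto simp: complete_signed_graph_def signed_graph_def)

text \<open>With \<open>s = card (S \<inter> P i)\<close>, a vertex of \<open>P i - S\<close> has
  negative degree \<open>s\<close> and positive degree \<open>card S - s\<close> into
  \<open>S\<close>; outside \<open>S\<close> its positive degree is
  \<open>(card (verts G) - card (P i)) - (card S - s)\<close>. Again \<open>s\<close> cancels, but
  \<open>w\<close> is not among the vertices counted here, so the \<open>+ 1\<close>
  survives.\<close>

lemma alliance_iff:
  assumes S: "S \<subseteq> verts G" "S \<noteq> {}"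
  shows "offensive_alliance G S \<longleftrightarrow> (\<forall>i\<in>{1..k}. \<not> P i \<subseteq> S \<longrightarrow>
    card S \<le> 2 * card (S \<inter> P i) \<and> card (verts G) + 1 \<le> card S + card (P i))"
proof -
  have cond: "neg_deg G S w \<ge> pos_deg G S w \<and> neg_deg G S w \<ge> pos_deg G (verts G - S) w + 1 \<longleftrightarrow>
      card S \<le> 2 * card (S \<inter> P i) \<and> card (verts G) + 1 \<le> card S + card (P i)"
    if i: "i \<in> {1..k}" and w: "w \<in> P i" "w \<notin> S" for i w
  proof -
    have "neg_nbrs G w \<inter> S = S \<inter> P i" "pos_nbrs G w \<inter> S = S - P i"
      "pos_nbrs G w \<inter> (verts G - S) = (verts G - P i) - (S - P i)"
      using E_nbrs[OF i w(1)] F_nbrs[OF i w(1)] S(1) w(2) P_subset[OF i]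
      by (auto simp: neg_nbrs_def pos_nbrs_def)
    moreover have "card (S - P i) \<le> card (verts G - P i)"
      using fin S(1) by (intro card_mono) auto
    moreover have "card ((verts G - P i) - (S - P i)) = card (verts G - P i) - card (S - P i)"
      using fin S(1) by (intro card_Diff_subset) (auto intro: finite_subset)
    ultimately show ?thesis
      using card_Diff_P[OF S(1) i] by (auto simp: neg_deg_def pos_deg_def)
  qed
  show ?thesis
    unfolding offensive_alliance_def bdry_complete[OF complete S]
  proof (intro iffI conjI ballI impI)
    fix i assume *: "S \<subseteq> verts G \<and> (\<forall>w\<in>verts G - S. neg_deg G S w \<ge> pos_deg G S w \<and>
        neg_deg G S w \<ge> pos_deg G (verts G - S) w + 1)" and i: "i \<in> {1..k}" "\<not> P i \<subseteq> S"
    then obtain w where "w \<in> P i" "w \<notin> S" by blast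
    with * i cond[of i w] P_subset[of i]
    show "card S \<le> 2 * card (S \<inter> P i)" "card (verts G) + 1 \<le> card S + card (P i)" by blast+
  next
    fix w assume *: "\<forall>i\<in>{1..k}. \<not> P i \<subseteq> S \<longrightarrow>
        card S \<le> 2 * card (S \<inter> P i) \<and> card (verts G) + 1 \<le> card S + card (P i)"
      and w: "w \<in> verts G - S"
    then obtain i where "i \<in> {1..k}" "w \<in> P i" using ex_P by blast
    with * w cond[of i w]
    show "neg_deg G S w \<ge> pos_deg G S w" "neg_deg G S w \<ge> pos_deg G (verts G - S) w + 1" by blast+
  qed (use S in auto)
qed

lemma one_in: "1 \<in> {1..k}"
  using k_pos by simp

lemma verts_nonempty: "verts G \<noteq> {}"
  using P_subset[OF one_in] P_nonempty[OF one_in] by blast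

text \<open>A third component \<open>P l\<close> would miss \<open>S\<close>, hence violate \<open>\<bar>S\<bar> \<le> 2 \<bar>S \<inter> P l\<bar>\<close>.\<close>

lemma two_uncovered:
  assumes "offensive_alliance G S" "S \<noteq> {}"
    and i: "i \<in> {1..k}" "\<not> P i \<subseteq> S" and j: "j \<in> {1..k}" "\<not> P j \<subseteq> S" and "i \<noteq> j"
  shows "card S = 2 * card (S \<inter> P i)" "card S = 2 * card (S \<inter> P j)" "{1..k} = {i, j}"
proof -
  have S: "S \<subseteq> verts G" using assms by (simp add: offensive_alliance_def)
  note A = iffD1[OF alliance_iff[OF S assms(2)] assms(1), rule_format]
  have le: "card S \<le> 2 * card (S \<inter> P i)" "card S \<le> 2 * card (S \<inter> P j)"
    using A i j by blast+
  have sum: "card (S \<inter> P i) + card (S \<inter> P j) \<le> card S"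
    using card_two_parts_le S i j \<open>i \<noteq> j\<close> by blast
  show eq: "card S = 2 * card (S \<inter> P i)" "card S = 2 * card (S \<inter> P j)"
    using le sum by linarith+
  have fS: "finite S" using S fin finite_subset by blast
  have "l \<in> {i, j}" if l: "l \<in> {1..k}" for l
  proof (rule ccontr)
    assume l': "l \<notin> {i, j}"
    \<comment> \<open>The two disjoint traces have half the size of \<open>S\<close> each, so they
      exhaust it.\<close>
    have "S \<inter> P i \<union> S \<inter> P j = S"
    proof (rule card_subset_eq[OF fS])
      have "(S \<inter> P i) \<inter> (S \<inter> P j) = {}" using P_disjoint i j \<open>i \<noteq> j\<close> by blast
      then show "card (S \<inter> P i \<union> S \<inter> P j) = card S"
        using fS eq by (simp add: card_Un_disjoint)
    qed blast
    then have "S \<inter> P l = {}"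
      using P_disjoint[of l i] P_disjoint[of l j] l l' i j by blast
    moreover from this have "\<not> P l \<subseteq> S" using P_nonempty[OF l] by blast
    ultimately have "card S \<le> 0" using A[OF l] by simp
    then show False using fS assms(2) by simp
  qed
  then show "{1..k} = {i, j}" using i j by blast
qed

text \<open>Since \<open>i\<close> and \<open>j\<close> are the only indices, they are 1 and 2 in
  some order. Of the two size conditions the one for \<open>P 2\<close> is kept: that component is
  the smaller, so its condition is the stronger.\<close>

lemma two_uncovered_numbering:
  assumes "offensive_alliance G S" "S \<noteq> {}"
    and i: "i \<in> {1..k}" "\<not> P i \<subseteq> S" and j: "j \<in> {1..k}" "\<not> P j \<subseteq> S" and "i \<noteq> j"
  shows "k = 2" "verts G = P 1 \<union> P 2" "card S = 2 * card (S \<inter> P 2)" "card (S \<inter> P 2) < card (P 2)"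
    "card (verts G) + 1 \<le> card S + card (P 2)"
proof -
  have S: "S \<subseteq> verts G" using assms by (simp add: offensive_alliance_def)
  note two = two_uncovered[OF assms]
  have "card {1..k} = 2" using two(3) \<open>i \<noteq> j\<close> by (metis card_2_iff)
  then show k2: "k = 2" by simp
  have "{1..k} = {1, 2}" unfolding k2 by auto
  then show "verts G = P 1 \<union> P 2" using Union_P by auto
  have "2 \<in> {i, j}" using two(3) k2 by auto
  then have 2: "2 \<in> {1..k}" "\<not> P 2 \<subseteq> S" and "card S = 2 * card (S \<inter> P 2)"
    using i j two by auto
  then show "card S = 2 * card (S \<inter> P 2)" "card (S \<inter> P 2) < card (P 2)"
    using card_not_subset by blast+
  show "card (verts G) + 1 \<le> card S + card (P 2)"
    using iffD1[OF alliance_iff[OF S assms(2)] assms(1)] 2 by blast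
qed

text \<open>\<open>S\<close> contains everything outside \<open>P i\<close>, so
  \<open>card (verts G) - card (P i) = card S - card (S \<inter> P i)\<close>, which is at most half
  of \<open>card S\<close> and at most \<open>card (S \<inter> P i) < card (P i)\<close>. Hence
  \<open>P i\<close> has more than half of the vertices.\<close>

lemma one_uncovered:
  assumes "offensive_alliance G S" "S \<noteq> {}" and i: "i \<in> {1..k}" "\<not> P i \<subseteq> S"
    and others: "\<And>j. j \<in> {1..k} \<Longrightarrow> j \<noteq> i \<Longrightarrow> P j \<subseteq> S"
  shows "2 * (card (verts G) - card (P i)) \<le> card S" "card (verts G) + 1 \<le> card S + card (P i)"
    "card (verts G) < 2 * card (P i)"
proof -
  have S: "S \<subseteq> verts G" using assms by (simp add: offensive_alliance_def)
  have A: "card S \<le> 2 * card (S \<inter> P i)" "card (verts G) + 1 \<le> card S + card (P i)"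
    using iffD1[OF alliance_iff[OF S assms(2)] assms(1)] i by blast+
  have "verts G - P i \<subseteq> S"
  proof
    fix x assume x: "x \<in> verts G - P i"
    then obtain j where "j \<in> {1..k}" "x \<in> P j" using ex_P by blast
    with x show "x \<in> S" using others by blast
  qed
  then have "S - P i = verts G - P i" using S by blast
  then have "card (verts G) - card (P i) = card S - card (S \<inter> P i)"
    using card_Diff_P[OF S i(1)] by simp
  with A card_Diff_P[OF S i(1)] card_not_subset[OF i]
  show "2 * (card (verts G) - card (P i)) \<le> card S" "card (verts G) + 1 \<le> card S + card (P i)"
    "card (verts G) < 2 * card (P i)"
    by linarith+
qed

text \<open>Case split on the number of components not contained in \<open>S\<close>, reduced to the
  numerical facts from which all the lower bounds on \<open>card S\<close> below follow.\<close>

lemma alliance_cases [consumes 2, case_names all one two]: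
  assumes "offensive_alliance G S" "S \<noteq> {}"
  obtains (all) "S = verts G"
  | (one) i where "i \<in> {1..k}" "2 * (card (verts G) - card (P i)) \<le> card S"
      "card (verts G) + 1 \<le> card S + card (P i)" "card (verts G) < 2 * card (P i)"
  | (two) "k = 2" "verts G = P 1 \<union> P 2" "card S = 2 * card (S \<inter> P 2)"
      "card (S \<inter> P 2) < card (P 2)" "card (verts G) + 1 \<le> card S + card (P 2)"
proof (cases "\<exists>i\<in>{1..k}. \<not> P i \<subseteq> S")
  case False
  moreover have "S \<subseteq> verts G" using assms(1) by (simp add: offensive_alliance_def)
  ultimately have "S = verts G" using Union_P by blast
  then show ?thesis by (rule all)
next
  case True
  then obtain i where i: "i \<in> {1..k}" "\<not> P i \<subseteq> S" by blast
  show ?thesis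
  proof (cases "\<exists>j\<in>{1..k}. \<not> P j \<subseteq> S \<and> i \<noteq> j")
    case True
    then show ?thesis using two_uncovered_numbering[OF assms i] two by blast
  next
    case False
    then show ?thesis using one_uncovered[OF assms i] one i by blast
  qed
qed

section \<open>Anti-balanced graphs with two large components\<close>

text \<open>\<open>P 2\<close> is a component only if \<open>k \<ge> 2\<close>; for
  \<open>k = 1\<close> its value is arbitrary. A third component would be disjoint from all of
  \<open>verts G\<close>.\<close>

lemma card_two_components:
  assumes "k \<ge> 2" "verts G = P 1 \<union> P 2"
  shows "card (verts G) = card (P 1) + card (P 2)" "k = 2"
proof -
  have 12: "1 \<in> {1..k}" "2 \<in> {1..k}" using assms by auto
  show "card (verts G) = card (P 1) + card (P 2)"
    unfolding assms(2) using finite_P 12 P_disjoint[OF 12] by (simp add: card_Un_disjoint)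
  show "k = 2"
  proof (rule ccontr)
    assume "k \<noteq> 2"
    with assms have 3: "3 \<in> {1..k}" by simp
    have "P 3 \<inter> verts G = {}"
      unfolding assms(2) using P_disjoint[OF 3 12(1)] P_disjoint[OF 3 12(2)] by auto
    then show False using P_subset[OF 3] P_nonempty[OF 3] by blast
  qed
qed

text \<open>Equal parts give equality in the first inequality of \<open>alliance_iff\<close>. As
  \<open>card (verts G) = card (P 1) + card (P 2)\<close>, the second one for the smaller component
  \<open>P 2\<close> is exactly the bound on \<open>m\<close>.\<close>

lemma pair_alliance:
  assumes k: "k \<ge> 2" "verts G = P 1 \<union> P 2"
    and S: "S1 \<subseteq> P 1" "S2 \<subseteq> P 2" "card S1 = m" "card S2 = m" and m: "card (P 1) + 1 \<le> 2 * m"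
  shows "offensive_alliance G (S1 \<union> S2)" "card (S1 \<union> S2) = 2 * m" "S1 \<union> S2 \<noteq> {}"
proof -
  have 12: "1 \<in> {1..k}" "2 \<in> {1..k}" "{1..k} = {1, 2}"
    using k card_two_components(2)[OF k] by auto
  have disj: "P 1 \<inter> P 2 = {}" using P_disjoint[OF 12(1,2)] by simp
  have "finite S1" "finite S2" using S finite_P 12(1,2) finite_subset by blast+
  moreover have "S1 \<inter> S2 = {}" using S disj by blast
  ultimately show card: "card (S1 \<union> S2) = 2 * m" using S by (simp add: card_Un_disjoint)
  then show ne: "S1 \<union> S2 \<noteq> {}" using m by auto
  have "(S1 \<union> S2) \<inter> P 1 = S1" "(S1 \<union> S2) \<inter> P 2 = S2" using S disj by blast+
  moreover have "card (P 2) \<le> card (P 1)" using part_le_1 12 by blast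
  moreover have "S1 \<union> S2 \<subseteq> verts G" using S k by blast
  ultimately show "offensive_alliance G (S1 \<union> S2)"
    using alliance_iff[OF _ ne] card S m card_two_components(1)[OF k] unfolding 12(3) by simp
qed

lemma two_large_components:
  assumes k: "k \<ge> 2" "verts G = P 1 \<union> P 2" and large: "card (verts G) + 1 \<le> 3 * card (P 2)"
    and m: "m = (card (P 1) + 2) div 2"
  shows "a_so G = 2 * m"
    and "S1 \<subseteq> P 1 \<Longrightarrow> S2 \<subseteq> P 2 \<Longrightarrow> card S1 = m \<Longrightarrow> card S2 = m \<Longrightarrow>
      minimum_offensive_alliance G (S1 \<union> S2)"
proof -
  note n = card_two_components[OF k]
  have m': "card (P 1) + 1 \<le> 2 * m" unfolding m by linarith
  have 12: "1 \<in> {1..k}" "2 \<in> {1..k}" using k by auto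
  have le: "card (P 2) \<le> card (P 1)" using part_le_1 12 by blast
  \<comment> \<open>This is where the bound on \<open>card (P 2)\<close> enters: it reads
    \<open>card (P 1) + 1 \<le> 2 * card (P 2)\<close>, so subsets of size \<open>m\<close> exist in
    both components.\<close>
  have m2: "m \<le> card (P 2)" using large n unfolding m by linarith
  have min: "2 * m \<le> card S" if "offensive_alliance G S" "S \<noteq> {}" for S
    using that
  proof (cases rule: alliance_cases)
    case all
    then show ?thesis using n m2 le by simp
  next
    case (one i)
    have "i = 1 \<or> i = 2" using one(1) n(2) by auto
    \<comment> \<open>The smaller of two components cannot have more than half of the
      vertices.\<close>
    then have "i = 1" using one(4) n(1) le by auto
    then show ?thesis using one(2) n(1) m2 by simp
  next
    case two
    \<comment> \<open>This is
      \<open>card (P 1) + 1 \<le> card S = 2 * card (S \<inter> P 2)\<close>, put in the form that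
      division by 2 turns into \<open>m \<le> card (S \<inter> P 2)\<close>.\<close>
    then have "card (P 1) + 2 < (card (S \<inter> P 2) + 1) * 2" using n by simp
    then have "m < card (S \<inter> P 2) + 1" unfolding m by (rule less_mult_imp_div_less)
    then show ?thesis using two by simp
  qed
  obtain S1 where "S1 \<subseteq> P 1" "card S1 = m"
    using obtain_subset_with_card_n[of m "P 1"] m2 le by auto
  moreover obtain S2 where "S2 \<subseteq> P 2" "card S2 = m"
    using obtain_subset_with_card_n[OF m2] by blast
  ultimately show a: "a_so G = 2 * m"
    using pair_alliance[OF k, of S1 S2 m] m' min by (intro a_so_eqI[of G "S1 \<union> S2"]) auto
  show "minimum_offensive_alliance G (S1 \<union> S2)"
    if "S1 \<subseteq> P 1" "S2 \<subseteq> P 2" "card S1 = m" "card S2 = m" for S1 S2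
    using pair_alliance[OF k that m'] a by (simp add: minimum_offensive_alliance_def)
qed

section \<open>Anti-balanced graphs: one component with at least half of the vertices, or
  none\<close>

text \<open>Only \<open>P 1\<close> can be uncovered, and exactly half of the set lies in it. The
  size condition then says that some vertex lies outside \<open>P 1\<close>, which follows from
  \<open>ne\<close>: without such a vertex both pieces would be empty.\<close>

lemma complement_alliance:
  assumes S1: "S1 \<subseteq> P 1" "card S1 = card (verts G) - card (P 1)"
    and ne: "S1 \<union> (verts G - P 1) \<noteq> {}"
  shows "offensive_alliance G (S1 \<union> (verts G - P 1))"
    "card (S1 \<union> (verts G - P 1)) = 2 * (card (verts G) - card (P 1))"
    "card (verts G) - card (P 1) + 1 \<le> 2 * (card (verts G) - card (P 1))"
proof -
  let ?S = "S1 \<union> (verts G - P 1)"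
  have fS1: "finite S1" using S1 finite_P[OF one_in] finite_subset by blast
  have cd: "card (verts G - P 1) = card (verts G) - card (P 1)"
    using card_Diff_P[OF subset_refl one_in] by simp
  have "S1 \<inter> (verts G - P 1) = {}" using S1 by blast
  then show card: "card ?S = 2 * (card (verts G) - card (P 1))"
    using S1 cd fS1 fin by (simp add: card_Un_disjoint)
  have sub: "?S \<subseteq> verts G" using S1 P_subset[OF one_in] by blast
  then have "finite ?S" using fin finite_subset by blast
  then have "card ?S > 0" using ne by (simp add: card_gt_0_iff)
  then show pos: "card (verts G) - card (P 1) + 1 \<le> 2 * (card (verts G) - card (P 1))"
    unfolding card by linarith
  have "card ?S \<le> 2 * card (?S \<inter> P i) \<and> card (verts G) + 1 \<le> card ?S + card (P i)"
    if i: "i \<in> {1..k}" "\<not> P i \<subseteq> ?S" for i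
  proof -
    have "i = 1"
      using i P_disjoint[OF i(1) one_in] P_subset[OF i(1)] by blast
    moreover have "?S \<inter> P 1 = S1" using S1 by blast
    ultimately show ?thesis using card S1 pos by simp
  qed
  then show "offensive_alliance G ?S" using alliance_iff[OF sub ne] by blast
qed

text \<open>The term \<open>c + 1\<close> decides the maximum only for \<open>c = 0\<close>, where
  \<open>2 * c\<close> would be the size of the empty set; for \<open>c \<ge> 1\<close> the maximum
  is \<open>2 * c\<close>.\<close>

lemma large_component:
  assumes not2: "\<not> (k \<ge> 2 \<and> verts G = P 1 \<union> P 2 \<and> card (verts G) + 1 \<le> 3 * card (P 2))"
    and large: "card (verts G) \<le> 2 * card (P 1)"
  defines "c \<equiv> card (verts G) - card (P 1)"
  shows "a_so G = max (c + 1) (2 * c)"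
    and "S1 \<subseteq> P 1 \<Longrightarrow> card S1 = c \<Longrightarrow> S1 \<union> (verts G - P 1) \<noteq> {} \<Longrightarrow>
      minimum_offensive_alliance G (S1 \<union> (verts G - P 1))"
proof -
  have c: "card (verts G) = card (P 1) + c"
    unfolding c_def using card_Diff_P(6)[OF subset_refl one_in] by simp
  have pos: "card (P 1) > 0" using card_P_pos one_in by blast
  have min: "max (c + 1) (2 * c) \<le> card S" if "offensive_alliance G S" "S \<noteq> {}" for S
    using that
  proof (cases rule: alliance_cases)
    case all
    then show ?thesis using c pos large by simp
  next
    case (one i)
    then show ?thesis using c part_le_1[of i] by simp
  next
    case two
    then have "card (verts G) = card (P 1) + card (P 2)" using card_two_components by simp
    \<comment> \<open>Here \<open>card S < 2 * card (P 2)\<close>, so the size condition gives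
      \<open>card (verts G) + 1 \<le> 3 * card (P 2)\<close>, against \<open>not2\<close>.\<close>
    then show ?thesis using two not2 by simp
  qed
  show a: "a_so G = max (c + 1) (2 * c)"
  \<comment> \<open>For \<open>c = 0\<close> all edges are negative and any single vertex is an
    alliance.\<close>
  proof (cases "c = 0")
    case True
    then have P1: "P 1 = verts G"
      using c P_subset[OF one_in] fin by (intro card_subset_eq) auto
    have "i = 1" if i: "i \<in> {1..k}" for i
      using P_disjoint[OF i one_in] P_subset[OF i] P_nonempty[OF i] P1 by blast
    then have k1: "{1..k} = {1}" using one_in by blast
    obtain w where w: "w \<in> P 1" using P_nonempty[OF one_in] by blast
    then have "offensive_alliance G {w}"
      using alliance_iff[of "{w}"] P1 unfolding k1 by simp
    then show ?thesis using min True by (intro a_so_eqI[of G "{w}"]) auto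
  next
    case False
    have "c \<le> card (P 1)" using large c by simp
    then obtain S1 where S1: "S1 \<subseteq> P 1" "card S1 = c"
      using obtain_subset_with_card_n by metis
    then have "S1 \<union> (verts G - P 1) \<noteq> {}" using False by auto
    from complement_alliance[OF S1(1) _ this] S1(2) this show ?thesis
      unfolding c_def using min[unfolded c_def]
      by (intro a_so_eqI[of G "S1 \<union> (verts G - P 1)"]) auto
  qed
  show "minimum_offensive_alliance G (S1 \<union> (verts G - P 1))"
    if "S1 \<subseteq> P 1" "card S1 = c" "S1 \<union> (verts G - P 1) \<noteq> {}" for S1
    using complement_alliance[OF that(1) that(2)[unfolded c_def] that(3)] a that(3)
    by (simp add: minimum_offensive_alliance_def c_def)
qed

text \<open>Case \<open>one\<close> needs a component with more than half of the vertices and case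
  \<open>two\<close> gives \<open>card (verts G) \<le> 2 * card (P 1)\<close>; only
  \<open>S = verts G\<close> is left.\<close>

lemma small_components:
  assumes "2 * card (P 1) < card (verts G)"
  shows "a_so G = card (verts G)"
proof (rule a_so_eqI[OF offensive_alliance_verts[OF complete] verts_nonempty refl])
  fix S assume "offensive_alliance G S" "S \<noteq> {}"
  then show "card (verts G) \<le> card S"
  proof (cases rule: alliance_cases)
    case (one i)
    then show ?thesis using part_le_1[of i] assms by simp
  next
    case two
    then show ?thesis using card_two_components part_le_1[of 2] assms by simp
  qed simp
qed

end

section \<open>Assembling the theorem\<close>

lemma ceiling_half: "\<lceil>(real a + 1) / 2\<rceil> = int ((a + 2) div 2)"
proof -
  have "real (a + 2) = 2 * real ((a + 2) div 2) + real ((a + 2) mod 2)"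
    by (metis mult_div_mod_eq of_nat_add of_nat_mult of_nat_numeral)
  moreover have "real ((a + 2) mod 2) \<le> 1" by (simp add: Suc_leI)
  ultimately show ?thesis by (intro ceiling_unique) auto
qed

text \<open>The anti-balanced cases overlap: \<open>V = V 1 \<union> V 2\<close> with
  \<open>V 1\<close> the larger forces \<open>card (V 1) \<ge> n / 2\<close>, and for two components
  of size 4 the formulas give 6 and 8. The nested \<open>if\<close> gives the two-component case
  precedence. Non-emptiness is demanded of the last set because it is empty when \<open>V 1\<close>
  is everything.\<close>

theorem theorem1:
  fixes G :: "'a sgraph" and n :: nat
  assumes "complete_signed_graph G" and "n = card (verts G)"
  shows
    "(\<forall>k V. k \<ge> 1 \<and> weakly_balanced G k \<and>
        ordered_components (verts G) (pos_edges G) k V \<longrightarrow>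
        a_so G = card (V 1) \<and> minimum_offensive_alliance G (V 1) \<and>
        (\<forall>(p::nat) (i::nat \<Rightarrow> nat) (T::nat \<Rightarrow> 'a set) S.
          p \<ge> 2 \<and> i ` {1..p} \<subseteq> {1..k} \<and> strict_mono_on {1..p} i \<and>
          (\<forall>j\<in>{1..p}. T j \<noteq> {} \<and> T j \<subseteq> V (i j)) \<and> S = (\<Union>j\<in>{1..p}. T j) \<longrightarrow>
          (minimum_offensive_alliance G S \<longleftrightarrow>
            card S = card (V 1) \<and>
            (\<forall>l. is_arg_max (\<lambda>j. card (T j)) (\<lambda>j. j \<in> {1..p} \<and> V (i j) - T j \<noteq> {}) l \<longrightarrow>
                 card (V 1) \<ge> 2 * card (T l))))) \<and>
     (\<forall>k V. k \<ge> 1 \<and> weakly_anti_balanced G k \<and>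
        ordered_components (verts G) (neg_edges G) k V \<longrightarrow>
        (if k \<ge> 2 \<and> verts G = V 1 \<union> V 2 \<and> card (V 1) \<ge> card (V 2) \<and>
            int (card (V 2)) \<ge> \<lceil>(real n + 1) / 3\<rceil>
         then
           int (a_so G) = 2 * \<lceil>(real (card (V 1)) + 1) / 2\<rceil> \<and>
           (\<forall>S1 S2. S1 \<subseteq> V 1 \<and> S2 \<subseteq> V 2 \<and>
              int (card S1) = \<lceil>(real (card (V 1)) + 1) / 2\<rceil> \<and>
              int (card S2) = \<lceil>(real (card (V 1)) + 1) / 2\<rceil> \<longrightarrow>
              minimum_offensive_alliance G (S1 \<union> S2))
         else if real (card (V 1)) \<ge> real n / 2
         then
           a_so G = max (n - card (V 1) + 1) (2 * (n - card (V 1))) \<and>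
           (\<forall>S1. S1 \<subseteq> V 1 \<and> card S1 = n - card (V 1) \<and> S1 \<union> (verts G - V 1) \<noteq> {} \<longrightarrow>
              minimum_offensive_alliance G (S1 \<union> (verts G - V 1)))
         else a_so G = n))"
proof (intro conjI allI impI; (elim conjE)?)
  fix k V
  assume k: "k \<ge> 1" and wb: "weakly_balanced G k"
    and oc: "ordered_components (verts G) (pos_edges G) k V"
  interpret balanced_graph G k V
    using wb oc by unfold_locales
      (auto simp: weakly_balanced_def complete_signed_graph_def signed_graph_def)
  show "a_so G = card (V 1)" "minimum_offensive_alliance G (V 1)"
    using a_so_eq P_1_minimum k by blast+
  fix p :: nat and i :: "nat \<Rightarrow> nat" and T :: "nat \<Rightarrow> 'a set" and S
  assume "p \<ge> 2" "i ` {1..p} \<subseteq> {1..k}" "strict_mono_on {1..p} i"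
    "\<forall>j\<in>{1..p}. T j \<noteq> {} \<and> T j \<subseteq> V (i j)" "S = (\<Union>j\<in>{1..p}. T j)"
  then show "minimum_offensive_alliance G S \<longleftrightarrow> card S = card (V 1) \<and>
      (\<forall>l. is_arg_max (\<lambda>j. card (T j)) (\<lambda>j. j \<in> {1..p} \<and> V (i j) - T j \<noteq> {}) l \<longrightarrow>
        card (V 1) \<ge> 2 * card (T l))"
    using k by (intro minimum_Union_iff) auto
next
  fix k V
  assume k: "k \<ge> 1" and wb: "weakly_anti_balanced G k"
    and oc: "ordered_components (verts G) (neg_edges G) k V"
  interpret anti_balanced_graph G k V
    using k wb oc by unfold_locales
      (auto simp: weakly_anti_balanced_def complete_signed_graph_def signed_graph_def)
  let ?A = "k \<ge> 2 \<and> verts G = V 1 \<union> V 2 \<and> card (verts G) + 1 \<le> 3 * card (V 2)"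
  have A: "k \<ge> 2 \<and> verts G = V 1 \<union> V 2 \<and> card (V 1) \<ge> card (V 2) \<and>
      int (card (V 2)) \<ge> \<lceil>(real n + 1) / 3\<rceil> \<longleftrightarrow> ?A"
    using part_le_1[of 2] by (auto simp: assms(2) ceiling_le_iff field_simps)
  have B: "real (card (V 1)) \<ge> real n / 2 \<longleftrightarrow> card (verts G) \<le> 2 * card (V 1)"
    by (auto simp: assms(2) field_simps)
  \<comment> \<open>The second branch keeps \<open>\<not> a\<close>, which becomes the hypothesis
    \<open>not2\<close> of \<open>large_component\<close>.\<close>
  have if_split: "if a then x else if b then y else z"
    if "a \<Longrightarrow> x" "\<not> a \<Longrightarrow> b \<Longrightarrow> y" "\<not> b \<Longrightarrow> z" for a b x y z
    using that by simp
  show "if k \<ge> 2 \<and> verts G = V 1 \<union> V 2 \<and> card (V 1) \<ge> card (V 2) \<and>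
            int (card (V 2)) \<ge> \<lceil>(real n + 1) / 3\<rceil>
         then
           int (a_so G) = 2 * \<lceil>(real (card (V 1)) + 1) / 2\<rceil> \<and>
           (\<forall>S1 S2. S1 \<subseteq> V 1 \<and> S2 \<subseteq> V 2 \<and>
              int (card S1) = \<lceil>(real (card (V 1)) + 1) / 2\<rceil> \<and>
              int (card S2) = \<lceil>(real (card (V 1)) + 1) / 2\<rceil> \<longrightarrow>
              minimum_offensive_alliance G (S1 \<union> S2))
         else if real (card (V 1)) \<ge> real n / 2
         then
           a_so G = max (n - card (V 1) + 1) (2 * (n - card (V 1))) \<and>
           (\<forall>S1. S1 \<subseteq> V 1 \<and> card S1 = n - card (V 1) \<and> S1 \<union> (verts G - V 1) \<noteq> {} \<longrightarrow>
              minimum_offensive_alliance G (S1 \<union> (verts G - V 1)))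
         else a_so G = n"
    unfolding A B ceiling_half of_nat_eq_iff unfolding assms(2)
  proof (rule if_split, goal_cases)
    case 1
    then show ?case using two_large_components by auto
  next
    case 2
    then show ?case using large_component by blast
  next
    case 3
    then show ?case using small_components by simp
  qed
qed

end
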